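(* Let $\mathfrak g=\mathfrak{sl}(n,\mathbb C)$, let $\mathbf S$ be the spin module attached to the diagonal Cartan subalgebra $\mathfrak t$, and let $\alpha=\epsilon_i-\epsilon_j$ with $1\le i<j\le n$ and $j-i>1$ (so that $\alpha$ is a positive root which is not simple). Then $\mu:=\rho(\mathfrak g)-\alpha$ is a dominant weight. We have $\mu=\mu[\lambda]$, where $\lambda=(\lambda_1,\ldots,\lambda_n)\in\mathrm{Part}(\binom n2;n)$ is the partition (Young diagram) obtained from $\lambda^0=(n-1,n-2,\ldots,0)$ by moving one box from the $i$-th row to the $j$-th row. Moreover, $\mathrm{mult}_{\mathbf S}(\mu)=2^{j-i-1}$.
   Context: $\epsilon_i\in\mathfrak t^*$ is the functional $\mathrm{diag}(t_1,\ldots,t_n)\mapsto t_i$, $\Phi^+=\{\epsilon_i-\epsilon_j:1\le i<j\le n\}$, $\rho(\mathfrak g)=\frac12\sum_{\alpha\in\Phi^+}\alpha$, $\varpi_i=\epsilon_1+\cdots+\epsilon_i$ ($1\le i\le n-1$). A weight $\sum x_i\varpi_i$ is dominant if all $x_i\ge0$. $\mathrm{Part}(\binom n2;n)$ is the set of sequences of nonnegative integers $\lambda_1\ge\cdots\ge\lambda_n$ with sum $\binom n2$; for such $\lambda$, $\mu[\lambda]=(\lambda_1-\lambda_2)\varpi_1+\cdots+(\lambda_{n-1}-\lambda_n)\varpi_{n-1}$. The spin module for $\mathfrak h=\mathfrak t$ is $\mathbf S=\bigwedge\mathfrak u^+$ with $\mathfrak u^+=\bigoplus_{\alpha\in\Phi^+}\mathfrak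 g_\alpha$ and $\mathfrak t$ acting through $\mathfrak t\xrightarrow{\mathrm{ad}}\mathfrak{so}(\mathfrak q)\subset\mathbf C(\mathfrak q)\to\mathrm{End}(\mathbf S)$ (Clifford multiplication), $\mathfrak q$ being the Killing-orthogonal complement of $\mathfrak t$. Its weights are $\mu(A)=\frac12\big(\sum_{\alpha\in\Phi^+\setminus A}\alpha-\sum_{\alpha\in A}\alpha\big)$, $A\subset\Phi^+$, and $\mathrm{mult}_{\mathbf S}(\mu)=\#\{A\subset\Phi^+:\mu(A)=\mu\}$. *)

theory Defs
  imports "Jordan_Normal_Form.Matrix" "HOL-Library.Function_Algebras"
begin

text \<open>Matrix rows and columns are numbered from 0, as in \<^theory>\<open>Jordan_Normal_Form.Matrix\<close>,
  whereas \<open>\<epsilon>\<^sub>i\<close>, \<open>\<varpi>\<^sub>i\<close> and the parts of a partition are numbered from 1.\<close>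

section \<open>The Lie algebra \<open>sl(n, \<complex>)\<close>\<close>

definition mtrace :: "complex mat \<Rightarrow> complex" where
  "mtrace x = (\<Sum>k<dim_row x. x $$ (k, k))"

definition sl :: "nat \<Rightarrow> complex mat set" where
  "sl n = {x \<in> carrier_mat n n. mtrace x = 0}"

definition cartan :: "nat \<Rightarrow> complex mat set" where
  "cartan n = {h \<in> sl n. diagonal_mat h}"

definition ad :: "complex mat \<Rightarrow> complex mat \<Rightarrow> complex mat" where
  "ad x y = x * y - y * x"

definition E :: "nat \<Rightarrow> nat \<Rightarrow> nat \<Rightarrow> complex mat" where
  "E n k l = mat n n (\<lambda>(r, s). if r = k \<and> s = l then 1 else 0)"

text \<open>The trace of \<open>ad x \<circ> ad y\<close> is computed on \<open>gl(n)\<close>, in the basis of matrix units.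
  For \<open>x, y \<in> sl(n)\<close> this is the trace on \<open>sl(n)\<close>, because \<open>gl(n) = sl(n) \<oplus> \<complex>1\<close>
  and \<open>ad y\<close> vanishes on \<open>\<complex>1\<close>.\<close>
definition killing :: "nat \<Rightarrow> complex mat \<Rightarrow> complex mat \<Rightarrow> complex" where
  "killing n x y = (\<Sum>k<n. \<Sum>l<n. ad x (ad y (E n k l)) $$ (k, l))"

definition \<qq> :: "nat \<Rightarrow> complex mat set" where
  "\<qq> n = {x \<in> sl n. \<forall>h \<in> cartan n. killing n x h = 0}"


section \<open>Weights\<close>

definition cscale :: "complex \<Rightarrow> ('a \<Rightarrow> complex) \<Rightarrow> 'a \<Rightarrow> complex" where
  "cscale c f = (\<lambda>x. c * f x)"

lemma vector_space_cscale: "vector_space (cscale :: complex \<Rightarrow> ('a \<Rightarrow> complex) \<Rightarrow> 'a \<Rightarrow> complex)"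
  by unfold_locales (auto simp: cscale_def algebra_simps fun_eq_iff)

text \<open>A linear functional on the Cartan subalgebra is represented by its extension by 0 to all
  matrices. Sums and multiples are pointwise, and equality of such functions is equality in
  the dual space.\<close>
definition eps :: "nat \<Rightarrow> nat \<Rightarrow> complex mat \<Rightarrow> complex" where
  "eps n i = (\<lambda>h. if h \<in> cartan n then h $$ (i - 1, i - 1) else 0)"

definition pos_roots :: "nat \<Rightarrow> (complex mat \<Rightarrow> complex) set" where
  "pos_roots n = {eps n i - eps n j | i j. 1 \<le> i \<and> i < j \<and> j \<le> n}"

definition simple_roots :: "nat \<Rightarrow> (complex mat \<Rightarrow> complex) set" where
  "simple_roots n = {eps n i - eps n (i + 1) | i. 1 \<le> i \<and> i + 1 \<le> n}"

definition rho :: "nat \<Rightarrow> complex mat \<Rightarrow> complex" where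
  "rho n = cscale (1 / 2) (\<Sum>\<alpha>\<in>pos_roots n. \<alpha>)"

definition fund_weight :: "nat \<Rightarrow> nat \<Rightarrow> complex mat \<Rightarrow> complex" where
  "fund_weight n k = (\<Sum>m\<in>{1..k}. eps n m)"

definition dominant_weight :: "nat \<Rightarrow> (complex mat \<Rightarrow> complex) \<Rightarrow> bool" where
  "dominant_weight n \<mu> \<longleftrightarrow>
     (\<exists>x :: nat \<Rightarrow> int. (\<forall>k\<in>{1..n-1}. x k \<ge> 0) \<and>
        \<mu> = (\<Sum>k\<in>{1..n-1}. cscale (of_int (x k)) (fund_weight n k)))"


section \<open>Partitions\<close>

definition Part :: "nat \<Rightarrow> nat \<Rightarrow> (nat \<Rightarrow> nat) set" where
  "Part m n = {lam. (\<forall>k l. 1 \<le> k \<and> k \<le> l \<and> l \<le> n \<longrightarrow> lam l \<le> lam k) \<and>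
                    (\<forall>k. k \<notin> {1..n} \<longrightarrow> lam k = 0) \<and> (\<Sum>k\<in>{1..n}. lam k) = m}"

definition staircase :: "nat \<Rightarrow> nat \<Rightarrow> nat" where
  "staircase n = (\<lambda>k. if k \<in> {1..n} then n - k else 0)"

text \<open>Moves one box from row \<open>i\<close>, assumed nonempty, to another row \<open>j\<close>.\<close>
definition move_box :: "(nat \<Rightarrow> nat) \<Rightarrow> nat \<Rightarrow> nat \<Rightarrow> nat \<Rightarrow> nat" where
  "move_box lam i j = lam(i := lam i - 1, j := lam j + 1)"

definition weight_of_part :: "nat \<Rightarrow> (nat \<Rightarrow> nat) \<Rightarrow> complex mat \<Rightarrow> complex" where
  "weight_of_part n lam =
     (\<Sum>k\<in>{1..n-1}. cscale (of_nat (lam k) - of_nat (lam (k + 1))) (fund_weight n k))"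


section \<open>The spin module\<close>

text \<open>The pair \<open>(k, l)\<close> stands for the root vector \<open>E n k l\<close>; these form a basis of \<open>\<uu>\<^sup>+\<close>.\<close>
definition upper :: "nat \<Rightarrow> (nat \<times> nat) set" where
  "upper n = {(k, l). k < l \<and> l < n}"

text \<open>The exterior algebra of \<open>\<uu>\<^sup>+\<close>. An element \<open>\<omega>\<close> is given by its coordinates with respect to
  the basis of monomials \<open>e\<^sub>A = \<alpha>\<^sub>1 \<and> \<dots> \<and> \<alpha>\<^sub>r\<close>, where \<open>A = {\<alpha>\<^sub>1 < \<dots> < \<alpha>\<^sub>r} \<subseteq> upper n\<close> in the
  lexicographic order.\<close>
type_synonym form = "(nat \<times> nat) set \<Rightarrow> complex"

definition spin_space :: "nat \<Rightarrow> form set" where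
  "spin_space n = {\<omega>. \<forall>A. \<not> A \<subseteq> upper n \<longrightarrow> \<omega> A = 0}"

definition pos_sign :: "nat \<times> nat \<Rightarrow> (nat \<times> nat) set \<Rightarrow> complex" where
  "pos_sign \<alpha> A =
     (- 1) ^ card {\<beta> \<in> A. fst \<beta> < fst \<alpha> \<or> fst \<beta> = fst \<alpha> \<and> snd \<beta> < snd \<alpha>}"

text \<open>Exterior multiplication by the \<open>\<uu>\<^sup>+\<close>-component of \<open>v\<close>.\<close>
definition wedge :: "nat \<Rightarrow> complex mat \<Rightarrow> form \<Rightarrow> form" where
  "wedge n v \<omega> = (\<lambda>A. if A \<subseteq> upper n
     then \<Sum>\<alpha>\<in>A. pos_sign \<alpha> A * v $$ \<alpha> * \<omega> (A - {\<alpha>}) else 0)"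

text \<open>Contraction (odd derivation of the exterior algebra) with a functional \<open>\<phi>\<close> on \<open>\<uu>\<^sup>+\<close>,
  given by its values on the root vectors.\<close>
definition contract :: "nat \<Rightarrow> (nat \<times> nat \<Rightarrow> complex) \<Rightarrow> form \<Rightarrow> form" where
  "contract n \<phi> \<omega> = (\<lambda>A. if A \<subseteq> upper n
     then \<Sum>\<alpha>\<in>upper n - A. pos_sign \<alpha> A * \<phi> \<alpha> * \<omega> (insert \<alpha> A) else 0)"

text \<open>Clifford multiplication by \<open>v \<in> \<qq> n\<close>, for the convention \<open>v w + w v = 2 \<langle>v, w\<rangle>\<close>
  in the Clifford algebra of the Killing form. As \<open>\<uu>\<^sup>+\<close> is isotropic, only the
  \<open>\<uu>\<^sup>-\<close>-component of \<open>v\<close> contributes to the contraction.\<close>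
definition cliff :: "nat \<Rightarrow> complex mat \<Rightarrow> form \<Rightarrow> form" where
  "cliff n v \<omega> = wedge n v \<omega> + contract n (\<lambda>(k, l). 2 * killing n v (E n k l)) \<omega>"

text \<open>The image of \<open>X \<in> so(\<qq>)\<close> in the Clifford algebra is \<open>1/4 \<Sum>\<^sub>i X(e\<^sub>i) e\<^sup>i\<close>, for a basis \<open>e\<^sub>i\<close>
  of \<open>\<qq>\<close> and its dual basis \<open>e\<^sup>i\<close> with respect to the Killing form: here the matrix units
  \<open>E n k l\<close> with \<open>k \<noteq> l\<close> and their dual vectors \<open>E n l k / \<langle>E n k l, E n l k\<rangle>\<close>. The action of
  \<open>h\<close> is obtained for \<open>X = ad h\<close>. With these conventions \<open>e\<^sub>A\<close> has weight
  \<open>1/2 (\<Sum>\<^sub>\<alpha>\<^sub>\<in>\<^sub>A \<alpha> - \<Sum>\<^sub>\<alpha>\<^sub>\<notin>\<^sub>A \<alpha>)\<close>.\<close>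
definition spin_act :: "nat \<Rightarrow> complex mat \<Rightarrow> form \<Rightarrow> form" where
  "spin_act n h \<omega> = cscale (1 / 4) (\<Sum>(k, l)\<in>{(k, l). k < n \<and> l < n \<and> k \<noteq> l}.
     cliff n (ad h (E n k l))
       (cliff n ((1 / killing n (E n k l) (E n l k)) \<cdot>\<^sub>m E n l k) \<omega>))"

definition spin_weight_space :: "nat \<Rightarrow> (complex mat \<Rightarrow> complex) \<Rightarrow> form set" where
  "spin_weight_space n \<mu> =
     {\<omega> \<in> spin_space n. \<forall>h\<in>cartan n. spin_act n h \<omega> = cscale (\<mu> h) \<omega>}"

definition mult_spin :: "nat \<Rightarrow> (complex mat \<Rightarrow> complex) \<Rightarrow> nat" where
  "mult_spin n \<mu> = vector_space.dim cscale (spin_weight_space n \<mu>)"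

end

theory Submission
  imports Defs
begin

text \<open>The monomials \<open>e\<^sub>A\<close> are weight vectors for \<open>spin_act\<close>, so multiplicities count
  subsets of \<open>upper n\<close>. Since \<open>\<rho>\<close> is half the sum of all positive roots, \<open>e\<^sub>A\<close> has weight
  \<open>\<rho> - \<alpha>\<close> iff the roots in the complement \<open>B\<close> of \<open>A\<close> sum to \<open>\<alpha>\<close>. Reading \<open>B\<close> as a set of
  arrows \<open>k \<rightarrow> l\<close> with \<open>k < l\<close>, this says that \<open>B\<close> is a unit flow from \<open>i\<close> to \<open>j\<close>, that is, an
  increasing path, which amounts to a subset of the \<open>j - i - 1\<close> vertices in between. The flows
  are counted by splitting off their first arrow.\<close>

section \<open>Dimension of coordinate subspaces\<close>

lemma sum_fun_apply: "(\<Sum>a\<in>S. f a) x = (\<Sum>a\<in>S. f a x)"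
  for f :: "'a \<Rightarrow> 'b \<Rightarrow> 'c::comm_monoid_add"
  by (induction S rule: infinite_finite_induct) auto

text \<open>The indicators \<open>d t\<close> of the points of \<open>T\<close> form a basis. Weight
  spaces of the spin module turn out to be such coordinate subspaces.\<close>

lemma dim_supported_functions:
  fixes T :: "'a set"
  assumes "finite T"
  shows "vector_space.dim cscale {f. \<forall>x. x \<notin> T \<longrightarrow> f x = (0::complex)} = card T"
proof -
  interpret V: vector_space "cscale :: complex \<Rightarrow> ('a \<Rightarrow> complex) \<Rightarrow> 'a \<Rightarrow> complex"
    by (rule vector_space_cscale)
  define d :: "'a \<Rightarrow> 'a \<Rightarrow> complex" where "d t = (\<lambda>x. if x = t then 1 else 0)" for t
  have inj: "inj_on d T"
    by (rule inj_onI) (metis d_def zero_neq_one)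
  have combination: "(\<Sum>t\<in>T. cscale (c t) (d t)) x = (if x \<in> T then c x else 0)" for c x
  proof -
    have "(\<Sum>t\<in>T. cscale (c t) (d t)) x = (\<Sum>t\<in>T. if x = t then c t else 0)"
      unfolding sum_fun_apply by (intro sum.cong) (auto simp: cscale_def d_def)
    also have "\<dots> = (if x \<in> T then c x else 0)"
      using assms by (simp add: sum.delta')
    finally show ?thesis .
  qed
  show ?thesis
  proof (rule V.dim_unique)
    show "d ` T \<subseteq> {f. \<forall>x. x \<notin> T \<longrightarrow> f x = 0}"
      by (auto simp: d_def)
    show "{f. \<forall>x. x \<notin> T \<longrightarrow> f x = 0} \<subseteq> V.span (d ` T)"
    proof
      fix f :: "'a \<Rightarrow> complex"
      assume "f \<in> {f. \<forall>x. x \<notin> T \<longrightarrow> f x = 0}"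
      then have "f = (\<Sum>t\<in>T. cscale (f t) (d t))"
        by (auto simp: fun_eq_iff combination)
      also have "\<dots> \<in> V.span (d ` T)"
        by (intro V.span_sum V.span_scale V.span_base) auto
      finally show "f \<in> V.span (d ` T)" .
    qed
    show "V.independent (d ` T)"
    proof (rule V.independent_if_scalars_zero)
      show "finite (d ` T)" using assms by simp
      fix g y
      assume zero: "(\<Sum>x\<in>d ` T. cscale (g x) x) = 0" and "y \<in> d ` T"
      then obtain t where t: "t \<in> T" "y = d t" by auto
      have "(\<Sum>s\<in>T. cscale (g (d s)) (d s)) = 0"
        using zero by (simp add: sum.reindex[OF inj])
      then show "g y = 0"
        using combination[of "\<lambda>s. g (d s)" t] t by simp
    qed
    show "card (d ` T) = card T" by (rule card_image[OF inj])
  qed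
qed

section \<open>Matrix units, commutators and the Killing form\<close>

lemma finite_upper [simp]: "finite (upper n)"
  by (rule finite_subset[of _ "{..<n} \<times> {..<n}"]) (auto simp: upper_def)

lemma upperD: "(k, l) \<in> upper n \<Longrightarrow> k < l \<and> k < n \<and> l < n"
  by (auto simp: upper_def)

lemma ad_index:
  assumes "x \<in> carrier_mat n n" "y \<in> carrier_mat n n" "p < n" "q < n"
  shows "ad x y $$ (p, q) = (\<Sum>r<n. x $$ (p, r) * y $$ (r, q)) - (\<Sum>r<n. y $$ (p, r) * x $$ (r, q))"
  using assms by (simp add: ad_def scalar_prod_def atLeast0LessThan)

lemma E_carrier [simp]: "E n k l \<in> carrier_mat n n"
  by (simp add: E_def)

lemma E_index [simp]:
  "p < n \<Longrightarrow> q < n \<Longrightarrow> E n k l $$ (p, q) = (if p = k \<and> q = l then 1 else 0)"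
  by (simp add: E_def)

lemma smult_E_index [simp]:
  "p < n \<Longrightarrow> q < n \<Longrightarrow> (c \<cdot>\<^sub>m E n k l) $$ (p, q) = (if p = k \<and> q = l then c else 0)"
  by (simp add: E_def)

lemma ad_E_index:
  assumes "x \<in> carrier_mat n n" "k < n" "l < n" "p < n" "q < n"
  shows "ad x (E n k l) $$ (p, q) =
    (if q = l then x $$ (p, k) else 0) - (if p = k then x $$ (l, q) else 0)"
proof -
  have "(\<Sum>r<n. x $$ (p, r) * E n k l $$ (r, q)) =
      (\<Sum>r<n. if r = k then (if q = l then x $$ (p, k) else 0) else 0)"
    using assms by (intro sum.cong) auto
  moreover have "(\<Sum>r<n. E n k l $$ (p, r) * x $$ (r, q)) =
      (\<Sum>r<n. if r = l then (if p = k then x $$ (l, q) else 0) else 0)"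
    using assms by (intro sum.cong) auto
  ultimately show ?thesis
    using assms by (simp add: ad_index)
qed

text \<open>On gl(n) the trace form of \<open>ad\<close> is
  \<open>2 n tr(x y) - 2 tr x tr y\<close>, and an off-diagonal matrix unit has trace 0. In the
  direct computation the pairs with \<open>p = l\<close> and those with \<open>q = k\<close> each
  contribute \<open>n\<close> copies of the entry.\<close>

lemma killing_E:
  assumes v: "v \<in> carrier_mat n n" and kl: "k < n" "l < n" "k \<noteq> l"
  shows "killing n v (E n k l) = 2 * of_nat n * v $$ (l, k)"
proof -
  have outer: "ad v (ad (E n k l) (E n p q)) $$ (p, q) =
      (if p = l then v $$ (l, k) else 0) + (if q = k then v $$ (l, k) else 0)"
    if pq: "p < n" "q < n" for p q
  proof -
    have inner: "ad (E n k l) (E n p q) $$ (r, s) =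
        (if r = k \<and> l = p \<and> s = q then 1 else 0) - (if r = p \<and> q = k \<and> s = l then 1 else 0)"
      if "r < n" "s < n" for r s
      using that pq kl by (subst ad_E_index) auto
    have "ad (E n k l) (E n p q) \<in> carrier_mat n n"
      unfolding ad_def by (intro minus_carrier_mat mult_carrier_mat[of _ n n]) auto
    then have "ad v (ad (E n k l) (E n p q)) $$ (p, q) =
        (\<Sum>r<n. v $$ (p, r) * ad (E n k l) (E n p q) $$ (r, q))
        - (\<Sum>r<n. ad (E n k l) (E n p q) $$ (p, r) * v $$ (r, q))"
      using v pq by (simp add: ad_index)
    \<comment> \<open>Because \<open>k \<noteq> l\<close>, at most one of the two matrix units in
      the bracket survives in each of the two products.\<close>
    also have "(\<Sum>r<n. v $$ (p, r) * ad (E n k l) (E n p q) $$ (r, q)) =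
        (\<Sum>r<n. if r = k then (if p = l then v $$ (l, k) else 0) else 0)"
      using pq kl by (intro sum.cong) (auto simp: inner)
    also have "(\<Sum>r<n. ad (E n k l) (E n p q) $$ (p, r) * v $$ (r, q)) =
        (\<Sum>r<n. if r = l then (if q = k then - v $$ (l, k) else 0) else 0)"
      using pq kl by (intro sum.cong) (auto simp: inner)
    finally show ?thesis
      using kl by simp
  qed
  have "killing n v (E n k l) = (\<Sum>p<n. \<Sum>q<n.
      (if p = l then v $$ (l, k) else 0) + (if q = k then v $$ (l, k) else 0))"
    unfolding killing_def by (intro sum.cong) (auto simp: outer)
  also have "\<dots> = (\<Sum>p<n. of_nat n * (if p = l then v $$ (l, k) else 0)) + of_nat n * v $$ (l, k)"
    using kl by (simp add: sum.distrib)
  also have "\<dots> = 2 * of_nat n * v $$ (l, k)"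
    using kl by (simp flip: sum_distrib_left)
  finally show ?thesis .
qed

section \<open>Clifford multiplication by root vectors\<close>

text \<open>Only elements strictly below \<open>\<alpha>\<close> are counted, so adding or removing
  \<open>\<alpha>\<close> keeps the sign. Hence the signs of a wedge and a contraction along the
  same root cancel.\<close>

lemma pos_sign_insert [simp]: "pos_sign \<alpha> (insert \<alpha> A) = pos_sign \<alpha> A"
  by (auto simp: pos_sign_def intro!: arg_cong[where f = "\<lambda>X. _ ^ card X"])

lemma pos_sign_remove [simp]: "pos_sign \<alpha> (A - {\<alpha>}) = pos_sign \<alpha> A"
  by (auto simp: pos_sign_def intro!: arg_cong[where f = "\<lambda>X. _ ^ card X"])

lemma pos_sign_square [simp]: "pos_sign \<alpha> A * (pos_sign \<alpha> A * z) = z"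
  by (simp add: pos_sign_def flip: mult.assoc power_add)

text \<open>The contraction part vanishes because two positive root vectors are orthogonal for the
  Killing form; the wedge part has a single nonzero entry to run over.\<close>

lemma cliff_raising:
  assumes "k < l" "l < n"
  shows "cliff n (c \<cdot>\<^sub>m E n k l) \<omega> A =
    (if A \<subseteq> upper n \<and> (k, l) \<in> A then pos_sign (k, l) A * c * \<omega> (A - {(k, l)}) else 0)"
proof -
  have "wedge n (c \<cdot>\<^sub>m E n k l) \<omega> A =
      (if A \<subseteq> upper n \<and> (k, l) \<in> A then pos_sign (k, l) A * c * \<omega> (A - {(k, l)}) else 0)"
  proof (cases "A \<subseteq> upper n")
    case True
    then have fin: "finite A" by (rule finite_subset) simp
    have "wedge n (c \<cdot>\<^sub>m E n k l) \<omega> A =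
        (\<Sum>\<alpha>\<in>A. if \<alpha> = (k, l) then pos_sign (k, l) A * c * \<omega> (A - {(k, l)}) else 0)"
      unfolding wedge_def if_P[OF True] using True assms
      by (intro sum.cong) (auto dest!: subsetD[OF True] upperD split: if_splits)
    then show ?thesis using fin True by simp
  qed (auto simp: wedge_def)
  moreover have "contract n (\<lambda>(p, q). 2 * killing n (c \<cdot>\<^sub>m E n k l) (E n p q)) \<omega> A = 0"
    unfolding contract_def using assms
    by (auto intro!: sum.neutral simp: upper_def killing_E)
  ultimately show ?thesis by (simp add: cliff_def)
qed

text \<open>A negative root vector has no entry above the diagonal, so nothing is wedged. The
  constant \<open>4 n\<close> is twice the Killing pairing \<open>2 n\<close> of opposite matrix
  units.\<close>

lemma cliff_lowering:
  assumes "k < l" "l < n"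
  shows "cliff n (c \<cdot>\<^sub>m E n l k) \<omega> A =
    (if A \<subseteq> upper n \<and> (k, l) \<notin> A
     then pos_sign (k, l) A * (4 * of_nat n * c) * \<omega> (insert (k, l) A) else 0)"
proof -
  have "wedge n (c \<cdot>\<^sub>m E n l k) \<omega> A = 0"
    unfolding wedge_def using assms
    by (auto intro!: sum.neutral dest!: subsetD[of A] upperD)
  moreover have "contract n (\<lambda>(p, q). 2 * killing n (c \<cdot>\<^sub>m E n l k) (E n p q)) \<omega> A =
    (if A \<subseteq> upper n \<and> (k, l) \<notin> A
     then pos_sign (k, l) A * (4 * of_nat n * c) * \<omega> (insert (k, l) A) else 0)"
  proof (cases "A \<subseteq> upper n")
    case True
    have "contract n (\<lambda>(p, q). 2 * killing n (c \<cdot>\<^sub>m E n l k) (E n p q)) \<omega> A =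
      (\<Sum>\<alpha>\<in>upper n - A. if \<alpha> = (k, l)
         then pos_sign (k, l) A * (4 * of_nat n * c) * \<omega> (insert (k, l) A) else 0)"
      unfolding contract_def if_P[OF True] using assms
      by (intro sum.cong) (auto simp: upper_def killing_E split: if_splits)
    then show ?thesis using True assms by (simp add: sum.delta') (simp add: upper_def)
  qed (auto simp: contract_def)
  ultimately show ?thesis by (simp add: cliff_def)
qed

section \<open>Diagonal action of the Cartan subalgebra on the spin module\<close>

lemma cartan_D:
  assumes "h \<in> cartan n"
  shows "h \<in> carrier_mat n n" "(\<Sum>k<n. h $$ (k, k)) = 0"
    and "\<And>k l. k < n \<Longrightarrow> l < n \<Longrightarrow> k \<noteq> l \<Longrightarrow> h $$ (k, l) = 0"
  using assms by (auto simp: cartan_def sl_def mtrace_def diagonal_mat_def)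

lemma ad_cartan_E:
  assumes "h \<in> cartan n" "k < n" "l < n"
  shows "ad h (E n k l) = (h $$ (k, k) - h $$ (l, l)) \<cdot>\<^sub>m E n k l"
proof (rule eq_matI)
  note h = cartan_D[OF assms(1)]
  show "dim_row (ad h (E n k l)) = dim_row ((h $$ (k, k) - h $$ (l, l)) \<cdot>\<^sub>m E n k l)"
    "dim_col (ad h (E n k l)) = dim_col ((h $$ (k, k) - h $$ (l, l)) \<cdot>\<^sub>m E n k l)"
    using h(1) by (auto simp: ad_def E_def)
  fix p q
  assume "p < dim_row ((h $$ (k, k) - h $$ (l, l)) \<cdot>\<^sub>m E n k l)"
    "q < dim_col ((h $$ (k, k) - h $$ (l, l)) \<cdot>\<^sub>m E n k l)"
  then have pq: "p < n" "q < n" by (auto simp: E_def)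
  show "ad h (E n k l) $$ (p, q) = ((h $$ (k, k) - h $$ (l, l)) \<cdot>\<^sub>m E n k l) $$ (p, q)"
    using assms(2,3) pq h(3) by (auto simp: ad_E_index[OF h(1)])
qed

text \<open>Each positive root occurs twice in the Clifford sum. The term \<open>(k, l)\<close>
  contracts with the root and then wedges it back, keeping the monomials that contain it; the term
  \<open>(l, k)\<close> does the reverse and keeps the others. Hence every monomial is an
  eigenvector.\<close>

lemma spin_act_diagonal:
  assumes h: "h \<in> cartan n" and A: "A \<subseteq> upper n"
  shows "spin_act n h \<omega> A = 1 / 2 * ((\<Sum>(k, l)\<in>A. h $$ (k, k) - h $$ (l, l))
    - (\<Sum>(k, l)\<in>upper n - A. h $$ (k, k) - h $$ (l, l))) * \<omega> A"
proof -
  define t where "t k l = h $$ (k, k) - h $$ (l, l)" for k l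
  define X where "X = (\<lambda>(k, l). cliff n (ad h (E n k l))
       (cliff n ((1 / killing n (E n k l) (E n l k)) \<cdot>\<^sub>m E n l k) \<omega>) A)"
  \<comment> \<open>The factor 2 is \<open>4 n\<close> from the contraction over the normalization
    \<open>2 n\<close>; the minus sign in \<open>lower\<close> comes from the negative root of
    \<open>E n l k\<close>.\<close>
  have raise: "X (k, l) = (if (k, l) \<in> A then 2 * t k l * \<omega> A else 0)"
    and lower: "X (l, k) = (if (k, l) \<in> A then 0 else - 2 * t k l * \<omega> A)" if "(k, l) \<in> upper n" for k l
  proof -
    from that have kl: "k < l" "l < n" "k < n" by (auto simp: upper_def)
    then have n: "of_nat n \<noteq> (0::complex)" by auto
    have "A - {(k, l)} \<subseteq> upper n" "insert (k, l) A \<subseteq> upper n" using A that by auto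
    then show "X (k, l) = (if (k, l) \<in> A then 2 * t k l * \<omega> A else 0)"
      and "X (l, k) = (if (k, l) \<in> A then 0 else - 2 * t k l * \<omega> A)"
      using kl A n
      by (auto simp: X_def t_def ad_cartan_E[OF h] killing_E cliff_raising cliff_lowering insert_absorb
          field_simps)
  qed
  have split: "{(k, l). k < n \<and> l < n \<and> k \<noteq> l} = upper n \<union> prod.swap ` upper n"
    by (auto simp: upper_def)
  have "spin_act n h \<omega> A = 1 / 4 * (\<Sum>\<alpha>\<in>upper n \<union> prod.swap ` upper n. X \<alpha>)"
    unfolding spin_act_def split
    by (simp add: cscale_def sum_fun_apply X_def case_prod_unfold)
  also have "(\<Sum>\<alpha>\<in>upper n \<union> prod.swap ` upper n. X \<alpha>)
      = (\<Sum>\<alpha>\<in>upper n. X \<alpha>) + (\<Sum>\<alpha>\<in>prod.swap ` upper n. X \<alpha>)"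
    by (intro sum.union_disjoint finite_imageI finite_upper) (auto simp: upper_def)
  also have "(\<Sum>\<alpha>\<in>prod.swap ` upper n. X \<alpha>) = (\<Sum>(k, l)\<in>upper n. X (l, k))"
    by (subst sum.reindex) (auto simp: o_def case_prod_unfold prod.swap_def)
  also have "(\<Sum>\<alpha>\<in>upper n. X \<alpha>) = (\<Sum>(k, l)\<in>upper n. X (k, l))"
    by simp
  also have "\<dots> = (\<Sum>\<alpha>\<in>upper n. if \<alpha> \<in> A then 2 * case_prod t \<alpha> * \<omega> A else 0)"
    by (intro sum.cong) (auto simp: raise)
  also have "\<dots> = (\<Sum>\<alpha>\<in>A. 2 * case_prod t \<alpha> * \<omega> A)"
    using A by (simp add: sum.inter_restrict[symmetric] Int_absorb1)
  also have "\<dots> = 2 * (\<Sum>\<alpha>\<in>A. case_prod t \<alpha>) * \<omega> A"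
    by (simp add: sum_distrib_left sum_distrib_right)
  also have "(\<Sum>(k, l)\<in>upper n. X (l, k))
      = (\<Sum>\<alpha>\<in>upper n. if \<alpha> \<in> - A then - 2 * case_prod t \<alpha> * \<omega> A else 0)"
    by (intro sum.cong) (auto simp: lower)
  also have "\<dots> = (\<Sum>\<alpha>\<in>upper n - A. - 2 * case_prod t \<alpha> * \<omega> A)"
    by (simp only: sum.inter_restrict[symmetric] finite_upper Diff_eq)
  also have "\<dots> = - 2 * (\<Sum>\<alpha>\<in>upper n - A. case_prod t \<alpha>) * \<omega> A"
    by (simp only: sum_distrib_left sum_distrib_right)
  also have "1 / 4 * (2 * P * w + - 2 * Q * w) = 1 / 2 * (P - Q) * w" for P Q w :: complex
    by (simp add: field_simps)
  finally show ?thesis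
    by (simp add: t_def case_prod_unfold)
qed

lemma cliff_outside: "\<not> A \<subseteq> upper n \<Longrightarrow> cliff n v \<omega> A = 0"
  by (simp add: cliff_def wedge_def contract_def)

lemma spin_act_outside: "\<not> A \<subseteq> upper n \<Longrightarrow> spin_act n h \<omega> A = 0"
  by (simp add: spin_act_def cscale_def sum_fun_apply case_prod_unfold cliff_outside)

text \<open>Coordinatewise the eigenvalue equation reads
  \<open>(w h A - \<mu> h) * \<omega> A = 0\<close>, so the weight vectors are exactly the forms
  supported on the sets \<open>A\<close> whose weight is \<open>\<mu>\<close>.\<close>

lemma mult_spin_eq_card:
  "mult_spin n \<mu> = card {A. A \<subseteq> upper n \<and> (\<forall>h\<in>cartan n.
     1 / 2 * ((\<Sum>(k, l)\<in>A. h $$ (k, k) - h $$ (l, l))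
       - (\<Sum>(k, l)\<in>upper n - A. h $$ (k, k) - h $$ (l, l))) = \<mu> h)}"
proof -
  define w where "w h A = 1 / 2 * ((\<Sum>(k, l)\<in>A. h $$ (k, k) - h $$ (l, l))
    - (\<Sum>(k, l)\<in>upper n - A. h $$ (k, k) - h $$ (l, l)))" for h :: "complex mat" and A
  define T where "T = {A. A \<subseteq> upper n \<and> (\<forall>h\<in>cartan n. w h A = \<mu> h)}"
  have act: "spin_act n h \<omega> A = w h A * \<omega> A" if "h \<in> cartan n" "A \<subseteq> upper n" for h \<omega> A
    unfolding w_def using that by (rule spin_act_diagonal)
  have "spin_weight_space n \<mu> = {\<omega>. \<forall>A. A \<notin> T \<longrightarrow> \<omega> A = 0}"
  proof (intro equalityI subsetI)
    fix \<omega>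
    assume \<omega>: "\<omega> \<in> spin_weight_space n \<mu>"
    have "\<omega> A = 0" if "A \<notin> T" for A
    proof (cases "A \<subseteq> upper n")
      case True
      with that obtain h where h: "h \<in> cartan n" and ne: "w h A \<noteq> \<mu> h"
        by (auto simp: T_def)
      have "spin_act n h \<omega> A = \<mu> h * \<omega> A"
        using \<omega> h by (simp add: spin_weight_space_def cscale_def)
      then have "w h A * \<omega> A = \<mu> h * \<omega> A"
        by (simp only: act[OF h True])
      with ne show ?thesis by simp
    next
      case False
      with \<omega> show ?thesis by (simp add: spin_weight_space_def spin_space_def)
    qed
    then show "\<omega> \<in> {\<omega>. \<forall>A. A \<notin> T \<longrightarrow> \<omega> A = 0}" by blast
  next
    fix \<omega> :: form
    assume "\<omega> \<in> {\<omega>. \<forall>A. A \<notin> T \<longrightarrow> \<omega> A = 0}"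
    then have zero: "\<omega> A = 0" if "A \<notin> T" for A
      using that by blast
    have "spin_act n h \<omega> A = \<mu> h * \<omega> A" if h: "h \<in> cartan n" for h A
    proof (cases "A \<subseteq> upper n")
      case True
      show ?thesis
        using h zero[of A] unfolding act[OF h True] by (cases "A \<in> T") (auto simp: T_def)
    next
      case False
      then have "A \<notin> T" by (simp add: T_def)
      then show ?thesis
        using False by (simp add: zero spin_act_outside)
    qed
    then have "spin_act n h \<omega> = cscale (\<mu> h) \<omega>" if "h \<in> cartan n" for h
      using that by (simp add: cscale_def fun_eq_iff)
    moreover have "\<omega> \<in> spin_space n"
      using zero by (auto simp: spin_space_def T_def)
    ultimately show "\<omega> \<in> spin_weight_space n \<mu>"
      by (simp add: spin_weight_space_def)
  qed
  moreover have "finite T"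
    by (rule finite_subset[of _ "Pow (upper n)"]) (auto simp: T_def)
  ultimately have "mult_spin n \<mu> = card T"
    by (simp add: mult_spin_def dim_supported_functions)
  then show ?thesis
    by (simp only: T_def w_def)
qed

section \<open>Unit flows and their number\<close>

text \<open>Outflow minus inflow at the vertex \<open>v\<close>; equally, the coefficient of the
  diagonal entry \<open>v\<close> in the sum of the roots in \<open>B\<close>. Vertices are numbered
  from 0, like matrix indices.\<close>

definition net :: "(nat \<times> nat) set \<Rightarrow> nat \<Rightarrow> int" where
  "net B v = (\<Sum>(k, l)\<in>B. of_bool (v = k) - of_bool (v = l))"

text \<open>For \<open>i = j\<close> the prescribed net outflow is zero everywhere; this case ends
  the recursion on the first arrow.\<close>

definition unit_flows :: "nat \<Rightarrow> nat \<Rightarrow> nat \<Rightarrow> (nat \<times> nat) set set" where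
  "unit_flows n i j = {B. B \<subseteq> upper n \<and> (\<forall>v. net B v = of_bool (v = i) - of_bool (v = j))}"

lemma net_insert:
  "finite B \<Longrightarrow> (k, l) \<notin> B \<Longrightarrow> net (insert (k, l) B) v = net B v + of_bool (v = k) - of_bool (v = l)"
  by (simp add: net_def)

text \<open>No arrow ends in the smallest vertex that is left by an arrow, so it is a source of the flow.\<close>
lemma unit_flow_source:
  assumes "B \<in> unit_flows n i j" "B \<noteq> {}"
  shows "i \<noteq> j" "e \<in> B \<Longrightarrow> i \<le> fst e" "\<exists>k. (i, k) \<in> B"
proof -
  have up: "B \<subseteq> upper n" and net: "\<And>v. net B v = of_bool (v = i) - of_bool (v = j)"
    using assms by (auto simp: unit_flows_def)
  then have fin: "finite B" by (auto intro: finite_subset)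
  define m where "m = Min (fst ` B)"
  have m_le: "m \<le> fst e" if "e \<in> B" for e
    using that fin by (auto simp: m_def)
  have "m \<in> fst ` B"
    unfolding m_def using fin assms(2) by (intro Min_in) auto
  then obtain k where k: "(m, k) \<in> B" by auto
  have "net B m = (\<Sum>e\<in>B. of_bool (m = fst e))"
    unfolding net_def case_prod_unfold
  proof (intro sum.cong refl)
    fix e assume e: "e \<in> B"
    then have "fst e < snd e" using up by (auto simp: upper_def)
    then show "of_bool (m = fst e) - of_bool (m = snd e) = (of_bool (m = fst e) :: int)"
      using m_le[OF e] by simp
  qed
  also have "\<dots> \<ge> of_bool (m = fst (m, k))"
    by (rule member_le_sum[OF k]) (auto simp: fin)
  \<comment> \<open>The net outflow at \<open>m\<close> is at least 1, while the prescribed values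
    are positive only at \<open>i\<close>, and there only if \<open>i \<noteq> j\<close>.\<close>
  finally have "m = i" "i \<noteq> j"
    using net[of m] by (auto simp: of_bool_def split: if_splits)
  then show "i \<noteq> j" "e \<in> B \<Longrightarrow> i \<le> fst e" "\<exists>k. (i, k) \<in> B"
    using m_le[of e] k by auto
qed

text \<open>A nonempty flow has a vertex with positive net outflow, which forces distinct end
  points.\<close>

lemma unit_flows_refl: "unit_flows n j j = {{}}"
  using unit_flow_source(1)[of _ n j j] by (auto simp: unit_flows_def net_def)

text \<open>All arrows leave vertices from \<open>i\<close> on and go upwards, so none touches
  \<open>j\<close>, yet the net outflow there would have to be \<open>- 1\<close>.\<close>

lemma unit_flows_empty:
  assumes "j < i"
  shows "unit_flows n i j = {}"
proof -
  have False if B: "B \<in> unit_flows n i j" for B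
  proof -
    have "net B j = 0"
      unfolding net_def
    proof (intro sum.neutral ballI)
      fix e assume e: "e \<in> B"
      then have "i \<le> fst e" "fst e < snd e"
        using unit_flow_source(2)[OF B, of e] B by (auto simp: unit_flows_def upper_def)
      then show "(case e of (k, l) \<Rightarrow> of_bool (j = k) - of_bool (j = l)) = (0::int)"
        using assms by (auto simp: case_prod_unfold)
    qed
    moreover have "net B j = - 1"
      using B assms by (simp add: unit_flows_def)
    ultimately show False by simp
  qed
  then show ?thesis by blast
qed

lemma unit_flow_fst_ge: "B \<in> unit_flows n i j \<Longrightarrow> (k, l) \<in> B \<Longrightarrow> i \<le> k"
  using unit_flow_source(2)[of B n i j "(k, l)"] by auto

text \<open>Deleting an arrow \<open>(i, k)\<close> moves the source from \<open>i\<close> to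
  \<open>k\<close>, and \<open>k \<le> j\<close> since there is no flow from above \<open>j\<close>.
  Conversely, the arrows of a flow from \<open>k > i\<close> all leave vertices above
  \<open>i\<close>, so \<open>(i, k)\<close> is new and may be added.\<close>

lemma unit_flows_first_step:
  assumes "i < j" "j < n"
  shows "unit_flows n i j = (\<Union>k\<in>{i<..j}. insert (i, k) ` unit_flows n k j)"
proof (intro equalityI subsetI)
  fix B assume B: "B \<in> unit_flows n i j"
  then have up: "B \<subseteq> upper n" and net: "\<And>v. net B v = of_bool (v = i) - of_bool (v = j)"
    by (auto simp: unit_flows_def)
  then have fin: "finite B" by (auto intro: finite_subset)
  have "B \<noteq> {}"
    using net[of i] assms by (auto simp: net_def)
  then obtain k where k: "(i, k) \<in> B"
    using unit_flow_source(3)[OF B] by blast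
  define B' where "B' = B - {(i, k)}"
  have eq: "B = insert (i, k) B'" and notin: "(i, k) \<notin> B'"
    using k by (auto simp: B'_def)
  have fin': "finite B'" using fin by (simp add: B'_def)
  have "net B' v = of_bool (v = k) - of_bool (v = j)" for v
    using net[of v] net_insert[OF fin' notin, of v] by (simp flip: eq)
  then have B': "B' \<in> unit_flows n k j"
    using up by (auto simp: unit_flows_def B'_def)
  have "i < k" using k up by (auto simp: upper_def)
  moreover have "k \<le> j"
    using B' unit_flows_empty[of j k n] by (cases "k \<le> j") auto
  ultimately show "B \<in> (\<Union>k\<in>{i<..j}. insert (i, k) ` unit_flows n k j)"
    using eq B' by auto
next
  fix B assume "B \<in> (\<Union>k\<in>{i<..j}. insert (i, k) ` unit_flows n k j)"
  then obtain k B' where k: "i < k" "k \<le> j" and B': "B' \<in> unit_flows n k j"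
    and eq: "B = insert (i, k) B'"
    by auto
  have "(i, k) \<notin> B'" using unit_flow_fst_ge[OF B'] k by fastforce
  moreover have "finite B'" using B' by (auto simp: unit_flows_def intro: finite_subset)
  ultimately show "B \<in> unit_flows n i j"
    using B' k assms by (auto simp: eq unit_flows_def net_insert upper_def)
qed

text \<open>A flow from \<open>k > i\<close> has no arrow leaving \<open>i\<close>. The added arrow
  is therefore the only one at \<open>i\<close>: it determines \<open>k\<close>, which makes the
  union disjoint, and it can be removed again, which makes each insertion injective.\<close>

lemma card_unit_flows_sum:
  assumes "i < j" "j < n"
  shows "card (unit_flows n i j) = (\<Sum>k\<in>{i<..j}. card (unit_flows n k j))"
proof -
  have notin: "(i, l) \<notin> B" if "B \<in> unit_flows n k j" "i < k" for B k l
    using unit_flow_fst_ge[OF that(1)] that(2) by fastforce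
  have fin: "finite (unit_flows n k j)" for k
    by (rule finite_subset[of _ "Pow (upper n)"]) (auto simp: unit_flows_def)
  have "card (unit_flows n i j) = (\<Sum>k\<in>{i<..j}. card (insert (i, k) ` unit_flows n k j))"
    unfolding unit_flows_first_step[OF assms]
  proof (rule card_UN_disjoint)
    show "\<forall>k\<in>{i<..j}. \<forall>k'\<in>{i<..j}. k \<noteq> k' \<longrightarrow>
        insert (i, k) ` unit_flows n k j \<inter> insert (i, k') ` unit_flows n k' j = {}"
    proof (intro ballI impI)
      fix k k'
      assume k: "k \<in> {i<..j}" "k' \<in> {i<..j}" "k \<noteq> k'"
      have False if "B \<in> unit_flows n k j" "B' \<in> unit_flows n k' j"
        "insert (i, k) B = insert (i, k') B'" for B B'
        using notin[OF that(1), of k'] that(3) k by auto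
      then show "insert (i, k) ` unit_flows n k j \<inter> insert (i, k') ` unit_flows n k' j = {}"
        by blast
    qed
  qed (auto simp: fin)
  also have "\<dots> = (\<Sum>k\<in>{i<..j}. card (unit_flows n k j))"
  proof (intro sum.cong refl card_image inj_onI)
    fix k B B'
    assume k: "k \<in> {i<..j}" and B: "B \<in> unit_flows n k j" "B' \<in> unit_flows n k j"
      and eq: "insert (i, k) B = insert (i, k) B'"
    from k have "i < k" by simp
    from notin[OF B(1) this] notin[OF B(2) this] eq show "B = B'"
      by (metis insert_ident)
  qed
  finally show ?thesis .
qed

text \<open>Splitting off \<open>k = Suc i\<close> in the recursion for \<open>i\<close> leaves the
  recursion sum for \<open>Suc i\<close>, which equals the term split off. So each further vertex
  between the end points doubles the count, and \<open>d\<close> is the number of these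
  vertices.\<close>

lemma card_unit_flows: "i + Suc d < n \<Longrightarrow> card (unit_flows n i (i + Suc d)) = 2 ^ d"
proof (induction d arbitrary: i)
  case 0
  have "{i<..Suc i} = {Suc i}" by auto
  with 0 show ?case
    by (simp add: card_unit_flows_sum unit_flows_refl)
next
  case (Suc d)
  define j where "j = i + Suc (Suc d)"
  have j: "Suc i < j" "j < n" using Suc.prems by (auto simp: j_def)
  have "{i<..j} = insert (Suc i) {Suc i<..j}" using j by auto
  then have "card (unit_flows n i j) = 2 * card (unit_flows n (Suc i) j)"
    using j by (simp add: card_unit_flows_sum[of i] card_unit_flows_sum[of "Suc i"])
  also have "card (unit_flows n (Suc i) j) = 2 ^ d"
    using Suc.IH[of "Suc i"] j by (simp add: j_def)
  finally show ?case by (simp add: j_def)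
qed

section \<open>Functionals on the Cartan subalgebra\<close>

lemma sum_of_bool_eq_mult:
  fixes k :: nat
  shows "k < n \<Longrightarrow> (\<Sum>v<n. of_bool (v = k) * f v) = (f k :: complex)"
  by (simp add: of_bool_def if_distrib[of "\<lambda>x. x * _"] cong: if_cong)

text \<open>Exchanging the sums collects, for each vertex, the contributions of the arrows at it.
  This links root sums to flows.\<close>

lemma sum_upper_subset_net:
  fixes f :: "nat \<Rightarrow> complex"
  assumes "B \<subseteq> upper n"
  shows "(\<Sum>(k, l)\<in>B. f k - f l) = (\<Sum>v<n. of_int (net B v) * f v)"
proof -
  have "f k - f l = (\<Sum>v<n. of_int (of_bool (v = k) - of_bool (v = l)) * f v)"
    if "(k, l) \<in> B" for k l
  proof -
    have "k < n" "l < n" using that assms by (auto simp: upper_def)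
    then show ?thesis
      by (simp add: left_diff_distrib sum_subtractf sum_of_bool_eq_mult)
  qed
  then have "(\<Sum>(k, l)\<in>B. f k - f l)
      = (\<Sum>e\<in>B. \<Sum>v<n. of_int (of_bool (v = fst e) - of_bool (v = snd e)) * f v)"
    by (intro sum.cong) auto
  also have "\<dots> = (\<Sum>v<n. \<Sum>e\<in>B. of_int (of_bool (v = fst e) - of_bool (v = snd e)) * f v)"
    by (rule sum.swap)
  finally show ?thesis
    by (simp add: net_def case_prod_unfold sum_distrib_right)
qed

text \<open>For \<open>a \<noteq> b\<close> this is a coroot; these matrices serve as test elements
  of the Cartan subalgebra.\<close>

definition diag_diff :: "nat \<Rightarrow> nat \<Rightarrow> nat \<Rightarrow> complex mat" where
  "diag_diff n a b = mat n n (\<lambda>(r, s). if r = s then of_bool (r = a) - of_bool (r = b) else 0)"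

lemma diag_diff_index: "v < n \<Longrightarrow> diag_diff n a b $$ (v, v) = of_bool (v = a) - of_bool (v = b)"
  by (simp add: diag_diff_def)

lemma diag_diff_cartan:
  assumes "a < n" "b < n"
  shows "diag_diff n a b \<in> cartan n"
proof -
  have "mtrace (diag_diff n a b) = (\<Sum>v<n. of_bool (v = a) - of_bool (v = b))"
    by (simp add: mtrace_def diag_diff_def)
  also have "\<dots> = 0"
    using assms by (simp add: sum_subtractf of_bool_def)
  finally show ?thesis
    by (auto simp: cartan_def sl_def diagonal_mat_def) (auto simp: diag_diff_def)
qed

text \<open>A functional that vanishes on traceless diagonal matrices is a multiple of the trace, as
  testing on coroots shows. Its equal coefficients vanish once their sum does.\<close>

lemma cartan_functional_zero:
  fixes c :: "nat \<Rightarrow> complex"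
  assumes zero: "\<And>h. h \<in> cartan n \<Longrightarrow> (\<Sum>v<n. c v * h $$ (v, v)) = 0"
    and sum: "(\<Sum>v<n. c v) = 0" and "a < n"
  shows "c a = 0"
proof -
  have "c b = c a" if "b < n" for b
  proof -
    have "(\<Sum>v<n. c v * diag_diff n a b $$ (v, v)) = (\<Sum>v<n. c v * (of_bool (v = a) - of_bool (v = b)))"
      by (intro sum.cong) (auto simp: diag_diff_index)
    also have "\<dots> = c a - c b"
      using that \<open>a < n\<close>
      by (simp add: right_diff_distrib sum_subtractf of_bool_def if_distrib[of "\<lambda>x. _ * x"] cong: if_cong)
    finally show ?thesis
      using zero[OF diag_diff_cartan[OF \<open>a < n\<close> that]] by simp
  qed
  then have "of_nat n * c a = 0"
    using sum by simp
  then show ?thesis using \<open>a < n\<close> by simp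
qed

text \<open>Restriction to trace 0 loses only multiples of the trace, and the coefficients of a
  combination of roots sum to 0. So an identity of functionals is the same as an identity of net
  outflows.\<close>

lemma unit_flows_cartan:
  assumes ij: "i < n" "j < n" and B: "B \<subseteq> upper n"
  shows "B \<in> unit_flows n i j \<longleftrightarrow>
    (\<forall>h\<in>cartan n. (\<Sum>(k, l)\<in>B. h $$ (k, k) - h $$ (l, l)) = h $$ (i, i) - h $$ (j, j))"
proof -
  define c where "c v = net B v - (of_bool (v = i) - of_bool (v = j))" for v
  have c: "(\<Sum>v<n. of_int (c v) * f v) = (\<Sum>(k, l)\<in>B. f k - f l) - (f i - f j)"
    for f :: "nat \<Rightarrow> complex"
    unfolding sum_upper_subset_net[OF B] using ij
    by (simp add: c_def left_diff_distrib sum_subtractf sum_of_bool_eq_mult)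
  \<comment> \<open>Flows are prescribed at every natural number, so the vertices beyond the matrix
    indices have to be treated separately.\<close>
  have "net B v = 0" if "n \<le> v" for v
    unfolding net_def using that B by (intro sum.neutral) (auto simp: upper_def)
  then have "c v = 0" if "n \<le> v" for v
    using that ij by (simp add: c_def)
  then have "(\<forall>v. c v = 0) \<longleftrightarrow> (\<forall>v<n. c v = 0)"
    by (metis not_le)
  then have "B \<in> unit_flows n i j \<longleftrightarrow> (\<forall>v<n. c v = 0)"
    using B by (simp add: unit_flows_def c_def)
  also have "\<dots> \<longleftrightarrow> (\<forall>h\<in>cartan n. (\<Sum>v<n. of_int (c v) * h $$ (v, v)) = 0)"
  proof
    assume "\<forall>h\<in>cartan n. (\<Sum>v<n. of_int (c v) * h $$ (v, v)) = 0"
    \<comment> \<open>On the constant function 1 every difference of entries is 0.\<close>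
    moreover have "(\<Sum>v<n. of_int (c v)) = (0::complex)"
      using c[of "\<lambda>_. 1"] by (simp add: case_prod_unfold)
    ultimately show "\<forall>v<n. c v = 0"
      using cartan_functional_zero[of n "\<lambda>v. of_int (c v)"] by auto
  qed simp
  finally show ?thesis
    by (simp add: c)
qed

text \<open>On the coroot of the left-hand root the left side is 2, and the right side reaches 2
  only when both indices agree.\<close>

lemma eps_diff_eq_iff:
  assumes "1 \<le> i" "i < j" "j \<le> n" "1 \<le> k" "k < l" "l \<le> n"
  shows "eps n i - eps n j = eps n k - eps n l \<longleftrightarrow> i = k \<and> j = l"
proof
  assume eq: "eps n i - eps n j = eps n k - eps n l"
  have "diag_diff n (i - 1) (j - 1) \<in> cartan n"
    using assms by (intro diag_diff_cartan) auto
  then have "diag_diff n (i - 1) (j - 1) $$ (i - 1, i - 1) - diag_diff n (i - 1) (j - 1) $$ (j - 1, j - 1)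
      = diag_diff n (i - 1) (j - 1) $$ (k - 1, k - 1) - diag_diff n (i - 1) (j - 1) $$ (l - 1, l - 1)"
    using fun_cong[OF eq, of "diag_diff n (i - 1) (j - 1)"] by (simp add: eps_def)
  then show "i = k \<and> j = l"
    using assms by (auto simp: diag_diff_index of_bool_def split: if_splits)
qed auto

section \<open>The weight \<open>rho\<close>, the staircase and weights of partitions\<close>

text \<open>Since \<open>pos_roots\<close> is a set of functionals, passing to a sum over index
  pairs requires that different pairs give different roots.\<close>

lemma rho_cartan:
  assumes "h \<in> cartan n"
  shows "rho n h = 1 / 2 * (\<Sum>(k, l)\<in>upper n. h $$ (k, k) - h $$ (l, l))"
proof -
  define r where "r = (\<lambda>(k, l). eps n (Suc k) - eps n (Suc l))"
  have "pos_roots n = r ` upper n"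
  proof (intro equalityI subsetI)
    fix \<alpha> assume "\<alpha> \<in> pos_roots n"
    then obtain i j where "\<alpha> = eps n i - eps n j" "1 \<le> i" "i < j" "j \<le> n"
      by (auto simp: pos_roots_def)
    then have "\<alpha> = r (i - 1, j - 1)" "(i - 1, j - 1) \<in> upper n"
      by (auto simp: r_def upper_def)
    then show "\<alpha> \<in> r ` upper n" by blast
  qed (force simp: pos_roots_def r_def upper_def)
  moreover have "inj_on r (upper n)"
    by (auto simp: inj_on_def r_def upper_def eps_diff_eq_iff)
  ultimately have "(\<Sum>\<alpha>\<in>pos_roots n. \<alpha>) = (\<Sum>e\<in>upper n. r e)"
    by (simp add: sum.reindex)
  then show ?thesis
    using assms by (simp add: rho_def cscale_def sum_fun_apply r_def case_prod_unfold eps_def)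
qed

text \<open>Functionals are extended by 0 to all matrices, so their equality must also be checked
  off the Cartan subalgebra.\<close>

lemma rho_outside: "h \<notin> cartan n \<Longrightarrow> rho n h = 0"
  by (auto simp: rho_def cscale_def sum_fun_apply pos_roots_def eps_def intro!: sum.neutral)

lemma weight_of_part_outside: "h \<notin> cartan n \<Longrightarrow> weight_of_part n lam h = 0"
  by (simp add: weight_of_part_def cscale_def sum_fun_apply fund_weight_def eps_def)

text \<open>The index \<open>v\<close> is the smaller one in \<open>n - 1 - v\<close> pairs and the
  larger one in \<open>v\<close> pairs. The induction adds the pairs whose larger index is the new
  one.\<close>

lemma sum_upper_diff:
  fixes f :: "nat \<Rightarrow> complex"
  shows "(\<Sum>(k, l)\<in>upper n. f k - f l) = (\<Sum>v<n. (of_nat n - 1 - 2 * of_nat v) * f v)"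
proof (induction n)
  case 0
  show ?case by (simp add: upper_def)
next
  case (Suc n)
  have "upper (Suc n) = upper n \<union> (\<lambda>k. (k, n)) ` {..<n}"
    by (auto simp: upper_def less_Suc_eq)
  moreover have "upper n \<inter> (\<lambda>k. (k, n)) ` {..<n} = {}"
    by (auto simp: upper_def)
  ultimately have "(\<Sum>(k, l)\<in>upper (Suc n). f k - f l)
      = (\<Sum>(k, l)\<in>upper n. f k - f l) + (\<Sum>k<n. f k - f n)"
    by (simp add: sum.union_disjoint sum.reindex inj_on_def)
  also have "\<dots> = (\<Sum>v<Suc n. (of_nat (Suc n) - 1 - 2 * of_nat v) * f v)"
    by (simp add: Suc.IH sum_subtractf algebra_simps sum.distrib sum_distrib_left)
  finally show ?case .
qed

text \<open>Summation by parts.\<close>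
lemma weight_of_part_cartan:
  assumes "h \<in> cartan n"
  shows "weight_of_part n lam h = (\<Sum>v<n. of_nat (lam (Suc v)) * h $$ (v, v))"
proof -
  define f where "f v = h $$ (v, v)" for v
  define a :: "nat \<Rightarrow> complex" where "a k = of_nat (lam k)" for k
  have parts: "(\<Sum>k<N. (a (Suc k) - a (Suc (Suc k))) * (\<Sum>v<Suc k. f v)) + a (Suc N) * (\<Sum>v<N. f v)
      = (\<Sum>v<N. a (Suc v) * f v)" for N
    by (induction N) (auto simp: algebra_simps)
  have "weight_of_part n lam h =
      (\<Sum>k<n - 1. (a (Suc k) - a (Suc (Suc k))) * (\<Sum>v<Suc k. f v))"
    using assms
    by (simp add: weight_of_part_def sum_fun_apply cscale_def fund_weight_def eps_def f_def a_def
        sum.atLeast1_atMost_eq del: sum.lessThan_Suc)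
  also have "\<dots> = (\<Sum>v<n. a (Suc v) * f v)"
  proof (cases n)
    case (Suc N)
    \<comment> \<open>Vanishing of the trace turns the boundary term into the missing summand at
      \<open>N\<close>.\<close>
    have "(\<Sum>v<N. f v) + f N = 0"
      using cartan_D(2)[OF assms] by (simp add: Suc f_def)
    then have F: "(\<Sum>v<N. f v) = - f N"
      by (simp add: eq_neg_iff_add_eq_0)
    have "(\<Sum>k<N. (a (Suc k) - a (Suc (Suc k))) * (\<Sum>v<Suc k. f v))
        = (\<Sum>v<N. a (Suc v) * f v) - a (Suc N) * (\<Sum>v<N. f v)"
      using parts[of N] by (simp only: eq_diff_eq)
    also have "\<dots> = (\<Sum>v<Suc N. a (Suc v) * f v)"
      by (simp add: F)
    finally show ?thesis
      by (simp only: Suc diff_Suc_1)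
  qed simp
  finally show ?thesis by (simp add: a_def f_def)
qed

text \<open>The coefficients \<open>n - 1 - v\<close> exceed those of \<open>rho\<close> by the
  constant \<open>(n - 1) / 2\<close>, which contributes a multiple of the trace, hence 0.\<close>

lemma rho_eq_staircase:
  assumes "h \<in> cartan n"
  shows "rho n h = (\<Sum>v<n. of_nat (staircase n (Suc v)) * h $$ (v, v))"
proof -
  have "(\<Sum>v<n. of_nat (staircase n (Suc v)) * h $$ (v, v))
      = (\<Sum>v<n. (1 / 2 * (of_nat n - 1 - 2 * of_nat v) + (of_nat n - 1) / 2) * h $$ (v, v))"
    by (intro sum.cong) (auto simp: staircase_def of_nat_diff field_simps)
  also have "\<dots> = 1 / 2 * (\<Sum>v<n. (of_nat n - 1 - 2 * of_nat v) * h $$ (v, v))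
      + (of_nat n - 1) / 2 * (\<Sum>v<n. h $$ (v, v))"
    by (simp only: sum_distrib_left sum.distrib distrib_right mult.assoc)
  finally show ?thesis
    using assms
    by (simp add: rho_cartan sum_upper_diff[of "\<lambda>v. h $$ (v, v)"] cartan_D(2))
qed

lemma dominant_weight_of_part:
  assumes "lam \<in> Part m n"
  shows "dominant_weight n (weight_of_part n lam)"
  unfolding dominant_weight_def
proof (intro exI[of _ "\<lambda>k. int (lam k) - int (lam (k + 1))"] conjI ballI)
  fix k assume "k \<in> {1..n - 1}"
  then have "lam (k + 1) \<le> lam k" using assms by (auto simp: Part_def)
  then show "0 \<le> int (lam k) - int (lam (k + 1))" by simp
qed (simp add: weight_of_part_def)

lemma sum_staircase: "(\<Sum>k\<in>{1..n}. staircase n k) = n choose 2"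
proof -
  have "(\<Sum>k\<in>{1..n}. staircase n k) = (\<Sum>v<n. n - Suc v)"
    by (simp add: staircase_def sum.atLeast1_atMost_eq)
  also have "\<dots> = (\<Sum>v<n. v)"
    by (rule sum.nat_diff_reindex)
  also have "\<dots> = n choose 2"
    by (induction n) (auto simp: numeral_2_eq_2)
  finally show ?thesis .
qed

text \<open>Consecutive rows of the staircase differ by one box. After the move, row
  \<open>i\<close> is as long as row \<open>i + 1\<close> and row \<open>j\<close> as long as row
  \<open>j - 1\<close>; the gap \<open>i + 1 < j\<close> keeps the rows weakly decreasing.\<close>

lemma move_box_staircase_Part:
  assumes "1 \<le> i" "i + 1 < j" "j \<le> n"
  shows "move_box (staircase n) i j \<in> Part (n choose 2) n"
proof -
  \<comment> \<open>Row \<open>i\<close> has \<open>n - i > 0\<close> boxes, so the truncated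
    subtraction in \<open>move_box\<close> is exact.\<close>
  have val: "int (move_box (staircase n) i j k) = int (staircase n k) - of_bool (k = i) + of_bool (k = j)" for k
    using assms by (auto simp: move_box_def staircase_def)
  have "int (\<Sum>k\<in>{1..n}. move_box (staircase n) i j k) = int (\<Sum>k\<in>{1..n}. staircase n k)"
    using assms by (simp add: val sum.distrib sum_subtractf of_bool_def)
  then have "(\<Sum>k\<in>{1..n}. move_box (staircase n) i j k) = n choose 2"
    by (simp only: of_nat_eq_iff sum_staircase)
  then show ?thesis
    using assms by (auto simp: Part_def move_box_def staircase_def)
qed

text \<open>The parts are the coefficients of the diagonal entries, so moving a box from row
  \<open>i\<close> to row \<open>j\<close> subtracts exactly the root.\<close>

lemma rho_minus_root:
  assumes "1 \<le> i" "i < j" "j \<le> n"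
  shows "rho n - (eps n i - eps n j) = weight_of_part n (move_box (staircase n) i j)"
proof
  fix h
  show "(rho n - (eps n i - eps n j)) h = weight_of_part n (move_box (staircase n) i j) h"
  proof (cases "h \<in> cartan n")
    case True
    have "of_nat (move_box (staircase n) i j (Suc v))
        = of_nat (staircase n (Suc v)) - of_bool (v = i - 1) + (of_bool (v = j - 1) :: complex)" for v
      using assms by (auto simp: move_box_def staircase_def of_nat_diff)
    moreover have "i - 1 < n" "j - 1 < n" using assms by auto
    ultimately have "weight_of_part n (move_box (staircase n) i j) h
        = rho n h - (h $$ (i - 1, i - 1) - h $$ (j - 1, j - 1))"
      using True
      by (simp add: weight_of_part_cartan rho_eq_staircase distrib_right left_diff_distrib
          sum.distrib sum_subtractf sum_of_bool_eq_mult)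
    with True show ?thesis by (simp add: eps_def)
  qed (simp add: rho_outside weight_of_part_outside eps_def)
qed

section \<open>Multiplicity of \<open>rho\<close> minus a nonsimple positive root\<close>

theorem proposition4p15:
  fixes n i j :: nat
  assumes "1 \<le> i" and "i < j" and "j \<le> n" and "j - i > 1"
  shows "eps n i - eps n j \<in> pos_roots n - simple_roots n
    \<and> dominant_weight n (rho n - (eps n i - eps n j))
    \<and> move_box (staircase n) i j \<in> Part (n choose 2) n
    \<and> rho n - (eps n i - eps n j) = weight_of_part n (move_box (staircase n) i j)
    \<and> mult_spin n (rho n - (eps n i - eps n j)) = 2 ^ (j - i - 1)"
proof (intro conjI)
  show "eps n i - eps n j \<in> pos_roots n - simple_roots n"
    using assms by (auto simp: pos_roots_def simple_roots_def eps_diff_eq_iff)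
  show part: "move_box (staircase n) i j \<in> Part (n choose 2) n"
    using assms by (intro move_box_staircase_Part) auto
  show weight: "rho n - (eps n i - eps n j) = weight_of_part n (move_box (staircase n) i j)"
    using assms by (intro rho_minus_root)
  show "dominant_weight n (rho n - (eps n i - eps n j))"
    unfolding weight by (rule dominant_weight_of_part[OF part])
  define S where "S h B = (\<Sum>(k, l)\<in>B. h $$ (k, k) - h $$ (l, l))" for h :: "complex mat" and B
  define T where "T = {A. A \<subseteq> upper n \<and> (\<forall>h\<in>cartan n.
    1 / 2 * (S h A - S h (upper n - A)) = (rho n - (eps n i - eps n j)) h)}"
  have flow_iff: "A \<in> T \<longleftrightarrow> upper n - A \<in> unit_flows n (i - 1) (j - 1)" if A: "A \<subseteq> upper n" for A
  proof -
    have "1 / 2 * (S h A - S h (upper n - A)) = (rho n - (eps n i - eps n j)) h \<longleftrightarrow>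
        S h (upper n - A) = h $$ (i - 1, i - 1) - h $$ (j - 1, j - 1)" if h: "h \<in> cartan n" for h
    proof -
      have "S h (upper n) = S h (upper n - A) + S h A"
        unfolding S_def by (rule sum.subset_diff[OF A finite_upper])
      then have "(rho n - (eps n i - eps n j)) h = 1 / 2 * (S h (upper n - A) + S h A)
          - (h $$ (i - 1, i - 1) - h $$ (j - 1, j - 1))"
        using h by (simp add: rho_cartan eps_def S_def)
      \<comment> \<open>With \<open>x\<close> and \<open>y\<close> the root sums over
        \<open>A\<close> and its complement and \<open>c\<close> the value of the root, the two
        weights differ by \<open>c - y\<close>.\<close>
      moreover have "1 / 2 * (x - y) - (1 / 2 * (y + x) - c) = c - y" for x y c :: complex
        by (simp add: field_simps)
      ultimately show ?thesis
        by (metis eq_iff_diff_eq_0)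
    qed
    then have "A \<in> T \<longleftrightarrow>
        (\<forall>h\<in>cartan n. S h (upper n - A) = h $$ (i - 1, i - 1) - h $$ (j - 1, j - 1))"
      using A by (simp add: T_def)
    also have "\<dots> \<longleftrightarrow> upper n - A \<in> unit_flows n (i - 1) (j - 1)"
      unfolding S_def using assms by (intro unit_flows_cartan[symmetric]) auto
    finally show ?thesis .
  qed
  have "bij_betw (\<lambda>A. upper n - A) T (unit_flows n (i - 1) (j - 1))"
  proof (rule bij_betw_byWitness[where f' = "\<lambda>B. upper n - B"])
    show "(\<lambda>A. upper n - A) ` T \<subseteq> unit_flows n (i - 1) (j - 1)"
      using flow_iff by (auto simp: T_def)
    show "(\<lambda>B. upper n - B) ` unit_flows n (i - 1) (j - 1) \<subseteq> T"
      using flow_iff by (auto simp: unit_flows_def double_diff)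
  qed (auto simp: T_def unit_flows_def)
  then have "card T = card (unit_flows n (i - 1) (j - 1))"
    by (rule bij_betw_same_card)
  also have "\<dots> = 2 ^ (j - i - 1)"
  proof -
    \<comment> \<open>Numbering from 0 shifts both end points, so \<open>j - i - 1\<close> still
      counts the vertices strictly between them.\<close>
    have "i - 1 + Suc (j - i - 1) = j - 1" using assms by simp
    then show ?thesis
      using card_unit_flows[of "i - 1" "j - i - 1" n] assms by simp
  qed
  finally show "mult_spin n (rho n - (eps n i - eps n j)) = 2 ^ (j - i - 1)"
    by (simp only: mult_spin_eq_card T_def S_def)
qed


end
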